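(* Let $k \geq 2$ and $t > (2k)^k$. If $\mathcal{H}$ is a $k$-uniform hypergraph, then Breaker has a winning strategy in $\mathbf{G}(\mathcal{H};q)$ provided that $$q > 4\max\left( \left( (2v(\mathcal{H}))^{1/t}\,\Delta_1(\mathcal{H})\, k e\right)^{\frac{1}{k-1}},\; 2k^2t^3\left( \max_{2\leq\ell\leq k-1}\left( \Delta_\ell(\mathcal{H})\left((tk)^{tk} k^t v(\mathcal{H})^2\right)^{\frac{k}{t^{1/k}}}\right)^{\frac{1}{k-\ell}} + 2\right)\right).$$
   Context: $e$ denotes the base of the natural logarithm. For a hypergraph $\mathcal{H}$, $v(\mathcal{H})$ is its number of vertices; $\deg(S)$ is the number of edges containing $S\subseteq V(\mathcal{H})$ and $\Delta_\ell(\mathcal{H}) = \max\{\deg(S) : |S| = \ell\}$. $\mathbf{G}(\mathcal{H};q)$ is the $q$-biased Maker-Breaker game: Maker and Breaker alternately occupy previously unoccupied vertices, Maker first, Maker one vertex per round and Breaker up to $q$; Maker wins iff he fully occupies an edge of $\mathcal{H}$, Breaker wins otherwise. *)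

theory Defs
  imports Complex_Main
begin

definition uniform_hypergraph :: "'a set \<Rightarrow> 'a set set \<Rightarrow> nat \<Rightarrow> bool" where
  "uniform_hypergraph V E k \<longleftrightarrow> finite V \<and> (\<forall>e\<in>E. e \<subseteq> V \<and> card e = k)"

definition hdeg :: "'a set set \<Rightarrow> 'a set \<Rightarrow> nat" where
  "hdeg E S = card {e \<in> E. S \<subseteq> e}"

text \<open>The inserted 0 only matters when there is no \<open>l\<close>-subset of \<open>V\<close>.\<close>

definition max_hdeg :: "'a set \<Rightarrow> 'a set set \<Rightarrow> nat \<Rightarrow> nat" where
  "max_hdeg V E l = Max (insert 0 (hdeg E ` {S. S \<subseteq> V \<and> card S = l}))"

text \<open>A history lists the completed rounds in chronological order; the entry \<open>(x, B)\<close> records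
  that Maker took \<open>x\<close> and Breaker answered with the set \<open>B\<close>. A strategy of Breaker maps the
  history and Maker's current move to Breaker's answer.\<close>

type_synonym 'a history = "('a \<times> 'a set) list"
type_synonym 'a breaker_strategy = "'a history \<Rightarrow> 'a \<Rightarrow> 'a set"

definition maker_set :: "'a history \<Rightarrow> 'a set" where
  "maker_set h = fst ` set h"

definition breaker_set :: "'a history \<Rightarrow> 'a set" where
  "breaker_set h = \<Union> (snd ` set h)"

definition free_set :: "'a set \<Rightarrow> 'a history \<Rightarrow> 'a set" where
  "free_set V h = V - maker_set h - breaker_set h"

inductive play :: "'a set \<Rightarrow> 'a breaker_strategy \<Rightarrow> 'a history \<Rightarrow> bool" for V \<sigma> where
  start: "play V \<sigma> []"
| round: "play V \<sigma> h \<Longrightarrow> x \<in> free_set V h \<Longrightarrow> play V \<sigma> (h @ [(x, \<sigma> h x)])"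

definition legal_breaker_strategy :: "'a set \<Rightarrow> nat \<Rightarrow> 'a breaker_strategy \<Rightarrow> bool" where
  "legal_breaker_strategy V q \<sigma> \<longleftrightarrow>
     (\<forall>h x. play V \<sigma> h \<longrightarrow> x \<in> free_set V h \<longrightarrow>
        \<sigma> h x \<subseteq> free_set V h - {x} \<and> card (\<sigma> h x) \<le> q)"

text \<open>Quantifying over all plays, not just those that exhaust the board, is harmless:
  Maker's set only grows and \<open>V\<close> is finite.\<close>

definition breaker_wins :: "'a set \<Rightarrow> 'a set set \<Rightarrow> nat \<Rightarrow> bool" where
  "breaker_wins V E q \<longleftrightarrow>
     (\<exists>\<sigma>. legal_breaker_strategy V q \<sigma> \<and>
          (\<forall>h. play V \<sigma> h \<longrightarrow> \<not> (\<exists>e\<in>E. e \<subseteq> maker_set h)))"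

end

(*
  Breaker splits his bias. With half of it he immediately occupies every vertex that would complete
  an edge; it remains to see that a single move of Maker never creates more than q/2 such threats.
  With the other half he plays the biased Erdos-Selfridge strategy, which bounds the weighted number
  of flowers occupied by Maker: a flower consists of a core S and a sequence of edges through S,
  each with one open vertex, whose remaining parts outside S are pairwise disjoint.

  If many threats pass through S but few through each S + z, then most sequences of these threats
  have disjoint petals, so that Maker would occupy too many flowers. Going down from |S| = k
  to |S| = 1 this bounds the threats n_l through a core of size l recursively by
  n_l = p_l k n_(l+1) + g_l, where p_l is the number of petals and g_l^(p_l) bounds the number of flowers
  with that core. The two terms of the maximum in the hypothesis are what is needed for l = 1, with
  about t petals, and for l >= 2, with about t^(1/k) / 2 petals.
*)
theory Submission
  imports Defs
begin

section \<open>The biased Erdos-Selfridge potential and the greedy reply\<close>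

text \<open>The family is indexed because different flowers may cover the same vertices, and all of
  them must be counted.\<close>

definition potential ::
    "real \<Rightarrow> 'i set \<Rightarrow> ('i \<Rightarrow> 'a set) \<Rightarrow> ('i \<Rightarrow> real) \<Rightarrow> 'a set \<Rightarrow> 'a set \<Rightarrow> real" where
  "potential r I A w M B = (\<Sum>i\<in>{i \<in> I. A i \<inter> B = {}}. w i * r ^ card (A i - M))"

definition danger ::
    "real \<Rightarrow> 'i set \<Rightarrow> ('i \<Rightarrow> 'a set) \<Rightarrow> ('i \<Rightarrow> real) \<Rightarrow> 'a set \<Rightarrow> 'a set \<Rightarrow> 'a \<Rightarrow> real" where
  "danger r I A w M B x = (\<Sum>i\<in>{i \<in> I. A i \<inter> B = {} \<and> x \<in> A i}. w i * r ^ card (A i - M))"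

lemma potential_insert_breaker:
  assumes "finite I"
  shows "potential r I A w M (insert y B) = potential r I A w M B - danger r I A w M B y"
proof -
  have eq: "{i \<in> I. A i \<inter> B = {}} =
      {i \<in> I. A i \<inter> insert y B = {}} \<union> {i \<in> I. A i \<inter> B = {} \<and> y \<in> A i}" by auto
  have "potential r I A w M B = potential r I A w M (insert y B) + danger r I A w M B y"
    unfolding potential_def danger_def eq by (rule sum.union_disjoint) (use assms in auto)
  then show ?thesis by simp
qed

text \<open>Every surviving set through \<open>x\<close> loses one missing vertex, so its term is
  multiplied by \<open>1 + b\<close>, that is, it grows by \<open>b\<close> times itself. With this
  ratio, \<open>b\<close> vertices of Breaker can balance one vertex of Maker.\<close>

lemma potential_insert_maker:
  assumes "finite I" "\<And>i. i \<in> I \<Longrightarrow> finite (A i)" "x \<notin> M"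
  shows "potential (1 / (1 + real b)) I A w (insert x M) B =
    potential (1 / (1 + real b)) I A w M B + real b * danger (1 / (1 + real b)) I A w M B x"
proof -
  let ?r = "1 / (1 + real b)"
  have step: "w i * ?r ^ card (A i - insert x M) = w i * ?r ^ card (A i - M) +
      (if x \<in> A i then real b * (w i * ?r ^ card (A i - M)) else 0)" if "i \<in> I" for i
  proof (cases "x \<in> A i")
    case True
    have "card (A i - M) = Suc (card (A i - insert x M))"
      using card_Suc_Diff1[of "A i - M" x] assms(2)[OF that] assms(3) True
      by (simp add: Diff_insert[symmetric])
    then have "(1 + real b) * ?r ^ card (A i - M) =
        (1 + real b) * ?r * ?r ^ card (A i - insert x M)" by simp
    moreover have "(1 + real b) * ?r = 1" by simp
    ultimately have "?r ^ card (A i - insert x M) = (1 + real b) * ?r ^ card (A i - M)"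
      by (simp only: mult_1_left)
    then show ?thesis using True by (simp add: algebra_simps)
  qed simp
  have "potential ?r I A w (insert x M) B =
      (\<Sum>i\<in>{i \<in> I. A i \<inter> B = {}}. w i * ?r ^ card (A i - M) +
        (if x \<in> A i then real b * (w i * ?r ^ card (A i - M)) else 0))"
    unfolding potential_def by (rule sum.cong) (use step in auto)
  also have "\<dots> = potential ?r I A w M B +
      (\<Sum>i\<in>{i \<in> {i \<in> I. A i \<inter> B = {}}. x \<in> A i}. real b * (w i * ?r ^ card (A i - M)))"
    unfolding potential_def sum.distrib using assms(1) by (subst (2) sum.inter_filter) auto
  also have "{i \<in> {i \<in> I. A i \<inter> B = {}}. x \<in> A i} = {i \<in> I. A i \<inter> B = {} \<and> x \<in> A i}" by auto
  finally show ?thesis unfolding danger_def by (simp add: sum_distrib_left)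
qed

lemma danger_antimono:
  assumes "finite I" "\<And>i. i \<in> I \<Longrightarrow> 0 \<le> w i" "0 \<le> r" "B \<subseteq> B'"
  shows "danger r I A w M B' x \<le> danger r I A w M B x"
  unfolding danger_def by (rule sum_mono2) (use assms in auto)

lemma potential_antimono:
  assumes "finite I" "\<And>i. i \<in> I \<Longrightarrow> 0 \<le> w i" "0 \<le> r" "B \<subseteq> B'"
  shows "potential r I A w M B' \<le> potential r I A w M B"
  unfolding potential_def by (rule sum_mono2) (use assms in auto)

text \<open>Take the most dangerous remaining vertex \<open>n\<close> times. Each choice lowers the
  potential by its danger at that time, which is at least the final danger of any \<open>x\<close>
  left over, since danger only falls as Breaker's set grows. If \<open>F\<close> runs out, nothing
  is left to show.\<close>

lemma greedy_reply_aux: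
  assumes "finite I" "\<And>i. i \<in> I \<Longrightarrow> 0 \<le> w i" "0 \<le> r" "finite F"
  shows "\<exists>Y\<subseteq>F. card Y \<le> n \<and> (\<forall>x\<in>F - Y. real n * danger r I A w M (B \<union> Y) x \<le>
           potential r I A w M B - potential r I A w M (B \<union> Y))"
proof (induction n)
  case 0
  show ?case by (intro exI[of _ "{}"]) auto
next
  case (Suc n)
  let ?\<phi> = "\<lambda>Y. danger r I A w M (B \<union> Y)" and ?P = "\<lambda>Y. potential r I A w M (B \<union> Y)"
  obtain Y where Y: "Y \<subseteq> F" "card Y \<le> n"
    and IH: "\<And>x. x \<in> F - Y \<Longrightarrow> real n * ?\<phi> Y x \<le> potential r I A w M B - ?P Y"
    using Suc.IH by blast
  show ?case
  proof (cases "F - Y = {}")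
    case True
    then show ?thesis using Y by (intro exI[of _ Y]) auto
  next
    case False
    have fin: "finite (?\<phi> Y ` (F - Y))" using assms(4) by simp
    have "Max (?\<phi> Y ` (F - Y)) \<in> ?\<phi> Y ` (F - Y)" using fin False by (intro Max_in) auto
    then obtain y where y: "y \<in> F - Y" and eq: "Max (?\<phi> Y ` (F - Y)) = ?\<phi> Y y" by blast
    have max: "?\<phi> Y x \<le> ?\<phi> Y y" if "x \<in> F - Y" for x
      unfolding eq[symmetric] using fin that by (intro Max_ge) auto
    have "real (Suc n) * ?\<phi> (insert y Y) x \<le> potential r I A w M B - ?P (insert y Y)"
      if x: "x \<in> F - insert y Y" for x
    proof -
      have "?\<phi> (insert y Y) x \<le> ?\<phi> Y x"
        by (rule danger_antimono) (use assms in auto)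
      then have "real (Suc n) * ?\<phi> (insert y Y) x \<le> real (Suc n) * ?\<phi> Y x"
        by (intro mult_left_mono) auto
      also have "\<dots> = real n * ?\<phi> Y x + ?\<phi> Y x" by (simp add: algebra_simps)
      also have "\<dots> \<le> potential r I A w M B - ?P Y + ?\<phi> Y y"
        by (intro add_mono IH max) (use x in auto)
      also have "\<dots> = potential r I A w M B - ?P (insert y Y)"
        by (simp add: potential_insert_breaker[OF assms(1)])
      finally show ?thesis .
    qed
    moreover have "card (insert y Y) \<le> Suc n"
      using Y finite_subset[OF Y(1) assms(4)] by (simp add: card_insert_if)
    ultimately show ?thesis using Y(1) y by (intro exI[of _ "insert y Y"]) auto
  qed
qed

text \<open>Maker's next vertex raises the potential by \<open>b\<close> times its danger after the
  reply, and the greedy choice has lowered it by at least as much beforehand.\<close>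

lemma greedy_reply:
  assumes "finite I" "\<And>i. i \<in> I \<Longrightarrow> 0 \<le> w i" "\<And>i. i \<in> I \<Longrightarrow> finite (A i)"
    and "finite F" "F \<inter> M = {}"
  shows "\<exists>Y\<subseteq>F. card Y \<le> b \<and> (\<forall>x\<in>F - Y.
           potential (1 / (1 + real b)) I A w (insert x M) (B \<union> Y) \<le>
           potential (1 / (1 + real b)) I A w M B)"
proof -
  let ?r = "1 / (1 + real b)"
  obtain Y where Y: "Y \<subseteq> F" "card Y \<le> b"
    and le: "\<And>x. x \<in> F - Y \<Longrightarrow> real b * danger ?r I A w M (B \<union> Y) x \<le>
           potential ?r I A w M B - potential ?r I A w M (B \<union> Y)"
    using greedy_reply_aux[where I=I and w=w and r="?r" and F=F and n=b and M=M and B=B and A=A] assms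
    by auto
  have "potential ?r I A w (insert x M) (B \<union> Y) \<le> potential ?r I A w M B" if "x \<in> F - Y" for x
  proof -
    have "x \<notin> M" using that assms(5) by blast
    from potential_insert_maker[OF assms(1,3) this, where B="B \<union> Y"]
    show ?thesis using le[OF that] by simp
  qed
  then show ?thesis using Y by blast
qed

section \<open>Breaker's strategy with split bias\<close>

text \<open>Breaker's vertices are not excluded, so that the set depends on Maker's position alone;
  the strategy discards those already taken.\<close>

definition threats :: "'a set \<Rightarrow> 'a set set \<Rightarrow> 'a set \<Rightarrow> 'a set \<Rightarrow> 'a set" where
  "threats V E M S = {y \<in> V - M. \<exists>e\<in>E. S \<subseteq> e \<and> y \<in> e \<and> e \<subseteq> insert y M}"

text \<open>Breaker takes all threats through Maker's last vertex and then replies greedily. The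
  potential is at most 1 after every move of Maker, so the sets he occupies weigh at most 1, and by
  \<open>few\<close> the bias suffices. The initial bound has a spare factor
  \<open>1 / (1 + b)\<close> for Maker's first move, which no reply precedes.\<close>

lemma breaker_wins_by_potential:
  fixes A :: "'i \<Rightarrow> 'a set"
  assumes V: "finite V" and E: "\<And>e. e \<in> E \<Longrightarrow> e \<subseteq> V \<and> 2 \<le> card e"
    and I: "finite I" "\<And>i. i \<in> I \<Longrightarrow> 0 \<le> w i" "\<And>i. i \<in> I \<Longrightarrow> A i \<subseteq> V"
    and init: "(\<Sum>i\<in>I. w i * (1 / (1 + real b)) ^ card (A i)) \<le> 1 / (1 + real b)"
    and few: "\<And>M x. M \<subseteq> V \<Longrightarrow> x \<in> M \<Longrightarrow> (\<Sum>i\<in>{i \<in> I. A i \<subseteq> M}. w i) \<le> 1 \<Longrightarrow>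
        card (threats V E M {x}) + b \<le> q"
  shows "breaker_wins V E q"
proof -
  let ?r = "1 / (1 + real b)"
  let ?P = "potential ?r I A w"
  have r: "0 \<le> ?r" by simp
  have finA: "finite (A i)" if "i \<in> I" for i using I(3)[OF that] V finite_subset by blast
  define T where "T = (\<lambda>h x. threats V E (insert x (maker_set h)) {x} - breaker_set h)"
  define F where "F = (\<lambda>h x. free_set V h - {x} - T h x)"
  define G where "G = (\<lambda>h x Y. Y \<subseteq> F h x \<and> card Y \<le> b \<and> (\<forall>x'\<in>F h x - Y.
      ?P (insert x' (insert x (maker_set h))) (breaker_set h \<union> T h x \<union> Y) \<le>
      ?P (insert x (maker_set h)) (breaker_set h \<union> T h x)))"
  define \<sigma> where "\<sigma> = (\<lambda>h x. T h x \<union> (SOME Y. G h x Y))"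
  have someG: "G h x (SOME Y. G h x Y)" for h x
  proof -
    have "\<exists>Y. G h x Y" unfolding G_def
      by (rule greedy_reply[where M="insert x (maker_set h)" and F="F h x"])
        (use I finA V in \<open>auto simp: F_def free_set_def\<close>)
    then show ?thesis by (rule someI_ex)
  qed
  \<comment> \<open>This holds whenever Maker is to move. The potential is taken one move ahead,
    where the greedy reply controls it; the edge clause says that every unblocked edge misses at
    least two vertices.\<close>
  define inv where "inv = (\<lambda>h. maker_set h \<subseteq> V \<and> maker_set h \<inter> breaker_set h = {} \<and>
      (\<forall>e\<in>E. e \<inter> breaker_set h = {} \<longrightarrow> (\<forall>y. \<not> e \<subseteq> insert y (maker_set h))) \<and>
      (\<forall>x\<in>free_set V h. ?P (insert x (maker_set h)) (breaker_set h) \<le> 1))"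
  have bound: "card (T h x) + b \<le> q" if h: "inv h" and x: "x \<in> free_set V h" for h x
  proof -
    let ?M = "insert x (maker_set h)"
    have M: "?M \<subseteq> V" "?M \<inter> breaker_set h = {}" using h x by (auto simp: inv_def free_set_def)
    \<comment> \<open>Sets inside \<open>?M\<close> miss no vertex and avoid Breaker's set, so each
      contributes exactly its weight to the potential.\<close>
    have "(\<Sum>i\<in>{i \<in> I. A i \<subseteq> ?M}. w i) = (\<Sum>i\<in>{i \<in> I. A i \<subseteq> ?M}. w i * ?r ^ card (A i - ?M))"
    proof (rule sum.cong)
      fix i assume "i \<in> {i \<in> I. A i \<subseteq> ?M}"
      then have "A i - ?M = {}" by auto
      then show "w i = w i * ?r ^ card (A i - ?M)" by (simp only: card.empty power_0 mult_1_right)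
    qed simp
    also have "\<dots> \<le> ?P ?M (breaker_set h)"
      unfolding potential_def by (rule sum_mono2) (use I M in auto)
    also have "\<dots> \<le> 1" using h x by (auto simp: inv_def)
    finally have "card (threats V E ?M {x}) + b \<le> q" using few[of ?M x] M by auto
    moreover have "card (T h x) \<le> card (threats V E ?M {x})"
      unfolding T_def by (rule card_mono) (use V in \<open>auto simp: threats_def\<close>)
    ultimately show ?thesis by simp
  qed
  have Tfree: "T h x \<subseteq> free_set V h - {x}" for h x
    by (auto simp: T_def threats_def free_set_def)
  have legal: "\<sigma> h x \<subseteq> free_set V h - {x} \<and> card (\<sigma> h x) \<le> q" if "inv h" "x \<in> free_set V h" for h x
  proof -
    have "card (\<sigma> h x) \<le> card (T h x) + card (SOME Y. G h x Y)"
      unfolding \<sigma>_def by (rule card_Un_le)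
    then show ?thesis
      using bound[OF that] someG[of h x] Tfree[of h x] by (auto simp: \<sigma>_def G_def F_def)
  qed
  have inv: "inv h" if "play V \<sigma> h" for h
    using that
  proof induction
    case start
    have "\<not> e \<subseteq> {y}" if "e \<in> E" for e y
      using E[OF that] card_mono[of "{y}" e] by auto
    moreover have "?P {x} {} \<le> 1" for x
    proof -
      have "?P {x} {} \<le> (\<Sum>i\<in>I. (1 + real b) * (w i * ?r ^ card (A i)))"
        unfolding potential_def
      proof (simp only: Int_empty_right simp_thms Collect_mem_eq, rule sum_mono)
        fix i assume i: "i \<in> I"
        have "card (A i) \<le> Suc (card (A i - {x}))"
          using card_insert_if[of "A i - {x}" x] card_mono[of "insert x (A i - {x})" "A i"]
            finA[OF i] by fastforce
        then have "?r ^ Suc (card (A i - {x})) \<le> ?r ^ card (A i)"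
          by (intro power_decreasing) auto
        then have "(1 + real b) * ?r * ?r ^ card (A i - {x}) \<le> (1 + real b) * ?r ^ card (A i)"
          unfolding power_Suc mult.assoc by (rule mult_left_mono) simp
        moreover have "(1 + real b) * ?r = 1" by simp
        ultimately have "?r ^ card (A i - {x}) \<le> (1 + real b) * ?r ^ card (A i)"
          by (simp only: mult_1_left)
        then show "w i * ?r ^ card (A i - {x}) \<le> (1 + real b) * (w i * ?r ^ card (A i))"
          by (subst mult.left_commute) (rule mult_left_mono[OF _ I(2)[OF i]])
      qed
      also have "\<dots> = (1 + real b) * (\<Sum>i\<in>I. w i * ?r ^ card (A i))"
        by (simp add: sum_distrib_left)
      also have "\<dots> \<le> (1 + real b) * ?r" by (intro mult_left_mono init) auto
      finally show ?thesis by simp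
    qed
    ultimately show ?case by (auto simp: inv_def maker_set_def breaker_set_def)
  next
    case (round h x)
    define h' where "h' = h @ [(x, \<sigma> h x)]"
    have M': "maker_set h' = insert x (maker_set h)"
      and B': "breaker_set h' = breaker_set h \<union> \<sigma> h x"
      by (auto simp: h'_def maker_set_def breaker_set_def)
    define Y where "Y = (SOME Y. G h x Y)"
    have Y: "G h x Y" unfolding Y_def by (rule someG)
    have \<sigma>: "\<sigma> h x = T h x \<union> Y" by (simp add: \<sigma>_def Y_def)
    note h = round.IH
    have x: "x \<in> free_set V h" by (rule round.hyps)
    have leg: "\<sigma> h x \<subseteq> free_set V h - {x}" using legal[OF h x] by simp
    have "maker_set h' \<subseteq> V" using h x by (auto simp: M' inv_def free_set_def)
    moreover have "maker_set h' \<inter> breaker_set h' = {}"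
      using h x leg by (auto simp: M' B' inv_def free_set_def)
    \<comment> \<open>Before the round \<open>e\<close> missed at least two vertices, so
      \<open>x\<close> is in \<open>e\<close> and \<open>y\<close> is the only one still missing.
      Then \<open>y\<close> is a threat through \<open>x\<close>, which Breaker has just taken.
      Hence only threats through the last vertex need an answer.\<close>
    moreover have "\<not> e \<subseteq> insert y (maker_set h')" if e: "e \<in> E" "e \<inter> breaker_set h' = {}" for e y
    proof
      assume sub: "e \<subseteq> insert y (maker_set h')"
      have eB: "e \<inter> breaker_set h = {}" using e B' by auto
      have none: "\<not> e \<subseteq> insert z (maker_set h)" for z using h e(1) eB by (auto simp: inv_def)
      have "x \<in> e" "y \<in> e" "y \<noteq> x" "y \<notin> maker_set h"
        using none[of x] none[of y] sub by (auto simp: M')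
      moreover have "y \<in> V" using E[OF e(1)] \<open>y \<in> e\<close> by auto
      moreover have "y \<notin> breaker_set h" using eB \<open>y \<in> e\<close> by auto
      ultimately have "y \<in> T h x"
        using e(1) sub by (auto simp: T_def threats_def M')
      then show False using e(2) \<open>y \<in> e\<close> by (auto simp: B' \<sigma>)
    qed
    moreover have "?P (insert z (maker_set h')) (breaker_set h') \<le> 1" if z: "z \<in> free_set V h'" for z
    proof -
      have "z \<in> F h x - Y" using z by (auto simp: F_def free_set_def M' B' \<sigma>)
      then have "?P (insert z (maker_set h')) (breaker_set h') \<le>
          ?P (insert x (maker_set h)) (breaker_set h \<union> T h x)"
        using Y by (auto simp: G_def M' B' \<sigma> Un_assoc)
      also have "\<dots> \<le> ?P (insert x (maker_set h)) (breaker_set h)"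
        by (rule potential_antimono) (use I r in auto)
      also have "\<dots> \<le> 1" using h x by (auto simp: inv_def)
      finally show ?thesis .
    qed
    ultimately show ?case unfolding inv_def h'_def by blast
  qed
  have "\<not> e \<subseteq> maker_set h" if "play V \<sigma> h" "e \<in> E" for e h
  proof
    assume sub: "e \<subseteq> maker_set h"
    note h = inv[OF that(1), unfolded inv_def]
    have "e \<inter> breaker_set h = {}" using h sub by blast
    then have "\<not> e \<subseteq> insert y (maker_set h)" for y using h that(2) by simp
    then show False using sub by blast
  qed
  moreover have "legal_breaker_strategy V q \<sigma>"
    unfolding legal_breaker_strategy_def using legal inv by simp
  ultimately show ?thesis unfolding breaker_wins_def by blast
qed

section \<open>Flowers: size and number\<close>

text \<open>What Maker must own outside the core for the open vertex to be the only one missing from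
  the edge.\<close>

definition petal :: "'a set \<Rightarrow> 'a set \<times> 'a \<Rightarrow> 'a set" where
  "petal S a = fst a - insert (snd a) S"

text \<open>An entry \<open>(e, y)\<close> of a flower is an edge together with its open vertex. Repetitions are
  allowed; by the disjointness condition they can only occur if the petals are empty.\<close>

definition flowers :: "'a set set \<Rightarrow> 'a set \<Rightarrow> nat \<Rightarrow> ('a set \<times> 'a) list set" where
  "flowers E S p = {L. set L \<subseteq> {(e, y). e \<in> E \<and> S \<subseteq> e \<and> y \<in> e - S} \<and> length L = p \<and>
     sorted_wrt (\<lambda>a b. petal S a \<inter> petal S b = {}) L}"

definition flower_set :: "'a set \<Rightarrow> ('a set \<times> 'a) list \<Rightarrow> 'a set" where
  "flower_set S L = S \<union> \<Union> (petal S ` set L)"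

lemma card_petal:
  assumes "uniform_hypergraph V E k" "e \<in> E" "S \<subseteq> e" "y \<in> e - S"
  shows "finite (petal S (e, y))" "card (petal S (e, y)) = k - 1 - card S"
proof -
  have e: "finite e" "card e = k" 
    using assms(1,2) finite_subset unfolding uniform_hypergraph_def by blast+
  have "finite S" using e(1) assms(3) finite_subset by blast
  then show "card (petal S (e, y)) = k - 1 - card S"
    using e assms(3,4) by (simp add: petal_def card_Diff_subset)
  show "finite (petal S (e, y))" using e by (simp add: petal_def)
qed

text \<open>Petals are disjoint from the core and from each other. All flowers with the same core
  and number of petals thus carry the same power of the ratio in the initial potential.\<close>

lemma card_flower_set:
  assumes "uniform_hypergraph V E k" "finite S" "L \<in> flowers E S p"
  shows "finite (flower_set S L) \<and> card (flower_set S L) = card S + p * (k - 1 - card S)"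
  using assms(3)
proof (induction L arbitrary: p)
  case Nil
  then show ?case using assms(2) by (auto simp: flowers_def flower_set_def)
next
  case (Cons a L)
  obtain e y where a: "a = (e, y)" by fastforce
  have pt: "e \<in> E" "S \<subseteq> e" "y \<in> e - S" "L \<in> flowers E S (length L)" "p = Suc (length L)"
    "\<And>b. b \<in> set L \<Longrightarrow> petal S a \<inter> petal S b = {}"
    using Cons.prems by (auto simp: flowers_def a)
  have eq: "flower_set S (a # L) = petal S a \<union> flower_set S L" by (auto simp: flower_set_def)
  have "petal S a \<inter> flower_set S L = {}"
    using pt(6) by (auto simp: flower_set_def petal_def)
  then show ?case
    using Cons.IH[OF pt(4)] card_petal[OF assms(1) pt(1-3)] unfolding eq
    by (simp add: card_Un_disjoint pt(5) a)
qed

lemma hdeg_le_max_hdeg: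
  assumes "finite V" "S \<subseteq> V"
  shows "hdeg E S \<le> max_hdeg V E (card S)"
  unfolding max_hdeg_def using assms by (intro Max_ge) auto

text \<open>Disjointness is dropped and the entries are counted independently: an edge through the
  core, then one of its \<open>k\<close> vertices.\<close>

lemma card_flowers_le:
  assumes "uniform_hypergraph V E k" "S \<subseteq> V"
  shows "finite (flowers E S p)" "card (flowers E S p) \<le> (max_hdeg V E (card S) * k) ^ p"
proof -
  let ?X = "Sigma {e \<in> E. S \<subseteq> e} (\<lambda>e. e)"
  have V: "finite V" and E: "\<And>e. e \<in> E \<Longrightarrow> e \<subseteq> V \<and> card e = k"
    using assms(1) by (auto simp: uniform_hypergraph_def)
  have "E \<subseteq> Pow V" using E by auto
  then have finE: "finite E" using V finite_subset by blast
  have fine: "finite e" if "e \<in> E" for e using E[OF that] V finite_subset by blast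
  have X: "finite ?X" using finE fine by auto
  have "card ?X = (\<Sum>e\<in>{e \<in> E. S \<subseteq> e}. card e)"
    using finE fine by (intro card_SigmaI) auto
  also have "\<dots> = hdeg E S * k" unfolding hdeg_def using E by simp
  also have "\<dots> \<le> max_hdeg V E (card S) * k"
    using hdeg_le_max_hdeg[OF V assms(2)] by simp
  finally have cX: "card ?X \<le> max_hdeg V E (card S) * k" .
  have sub: "flowers E S p \<subseteq> {L. set L \<subseteq> ?X \<and> length L = p}"
    by (auto simp: flowers_def)
  have fl: "finite {L. set L \<subseteq> ?X \<and> length L = p}"
    using X by (rule finite_lists_length_eq)
  show "finite (flowers E S p)" using sub fl by (rule finite_subset)
  have "card (flowers E S p) \<le> card ?X ^ p"
    using card_mono[OF fl sub] card_lists_length_eq[OF X] by simp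
  also have "\<dots> \<le> (max_hdeg V E (card S) * k) ^ p" using cX by (rule power_mono) simp
  finally show "card (flowers E S p) \<le> (max_hdeg V E (card S) * k) ^ p" .
qed

section \<open>From many threats to many flowers\<close>

text \<open>Extend a list at its front: every entry present rules out at most \<open>c\<close>
  elements, so at least \<open>card W - p * c\<close> choices remain at each step.\<close>

lemma card_compatible_lists_ge:
  fixes c :: real
  assumes W: "finite W" and conflict: "\<And>b. b \<in> W \<Longrightarrow> real (card {a \<in> W. \<not> R a b}) \<le> c"
    and c: "0 \<le> c" "real p * c \<le> real (card W)" and "n \<le> p"
  shows "(real (card W) - real p * c) ^ n \<le>
    real (card {L. set L \<subseteq> W \<and> length L = n \<and> sorted_wrt R L})"
  using \<open>n \<le> p\<close>
proof (induction n)
  case 0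
  have "{L. set L \<subseteq> W \<and> length L = 0 \<and> sorted_wrt R L} = {[]}" by auto
  then show ?case by simp
next
  case (Suc n)
  let ?d = "real (card W) - real p * c"
  let ?S = "{L. set L \<subseteq> W \<and> length L = n \<and> sorted_wrt R L}"
  let ?N = "\<lambda>L. {a \<in> W. \<forall>b\<in>set L. R a b}"
  have finS: "finite ?S"
    by (rule finite_subset[OF _ finite_lists_length_eq[OF W, of n]]) auto
  have N: "?d \<le> real (card (?N L))" if L: "L \<in> ?S" for L
  proof -
    let ?C = "\<Union>b\<in>set L. {a \<in> W. \<not> R a b}"
    have "real (card ?C) \<le> real (\<Sum>b\<in>set L. card {a \<in> W. \<not> R a b})"
      using card_UN_le[of "set L" "\<lambda>b. {a \<in> W. \<not> R a b}"] by (simp del: of_nat_sum)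
    also have "\<dots> \<le> (\<Sum>b\<in>set L. c)"
      unfolding of_nat_sum by (rule sum_mono) (use L conflict in auto)
    also have "\<dots> = real (card (set L)) * c" by simp
    also have "\<dots> \<le> real p * c"
      using L Suc.prems card_length[of L] c(1) by (intro mult_right_mono) auto
    finally have C: "real (card ?C) \<le> real p * c" .
    have "card W \<le> card (?N L \<union> ?C)" using W by (intro card_mono) auto
    also have "\<dots> \<le> card (?N L) + card ?C" by (rule card_Un_le)
    finally have "card W \<le> card (?N L) + card ?C" .
    then show ?thesis using C by linarith
  qed
  have "?d ^ Suc n \<le> real (card ?S) * ?d"
  proof -
    have "?d ^ n \<le> real (card ?S)" using Suc by simp
    then show ?thesis unfolding power_Suc2 by (rule mult_right_mono) (use c(2) in simp)
  qed
  also have "\<dots> = (\<Sum>L\<in>?S. ?d)" by simp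
  also have "\<dots> \<le> (\<Sum>L\<in>?S. real (card (?N L)))" by (rule sum_mono) (rule N)
  also have "\<dots> = real (card (Sigma ?S ?N))"
    using finS W by (subst card_SigmaI) auto
  also have "\<dots> = real (card ((\<lambda>(L, a). a # L) ` Sigma ?S ?N))"
    by (subst card_image) (auto simp: inj_on_def)
  also have "\<dots> \<le> real (card {L. set L \<subseteq> W \<and> length L = Suc n \<and> sorted_wrt R L})"
    by (intro of_nat_mono card_mono finite_subset[OF _ finite_lists_length_eq[OF W, of "Suc n"]]) auto
  finally show ?case .
qed

text \<open>A threat conflicts with another one only if they share some \<open>z\<close> outside \<open>S\<close>, and then both
  pass through \<open>insert z S\<close>; this is what drives the induction.\<close>

lemma card_threats_le:
  fixes n g :: "nat \<Rightarrow> real" and p :: "nat \<Rightarrow> nat"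
  assumes H: "uniform_hypergraph V E k" and M: "M \<subseteq> V"
    and g: "\<And>l. 1 \<le> l \<Longrightarrow> l < k \<Longrightarrow> 0 < g l" and p: "\<And>l. 1 \<le> l \<Longrightarrow> l < k \<Longrightarrow> 0 < p l"
    and n: "\<And>l. 1 \<le> l \<Longrightarrow> l \<le> k \<Longrightarrow> 0 \<le> n l"
    and rec: "\<And>l. 1 \<le> l \<Longrightarrow> l < k \<Longrightarrow> real (p l) * (real k * n (Suc l)) + g l \<le> n l"
    and few: "\<And>S. S \<subseteq> M \<Longrightarrow> 1 \<le> card S \<Longrightarrow> card S < k \<Longrightarrow>
      real (card {L \<in> flowers E S (p (card S)). flower_set S L \<subseteq> M}) \<le> g (card S) ^ p (card S)"
    and S: "S \<subseteq> M" "1 \<le> card S" "card S \<le> k"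
  shows "real (card (threats V E M S)) \<le> n (card S)"
  using S
proof (induction "k - card S" arbitrary: S)
  case 0
  have V: "finite V" and E: "\<And>e. e \<in> E \<Longrightarrow> e \<subseteq> V \<and> card e = k"
    using H by (auto simp: uniform_hypergraph_def)
  \<comment> \<open>A threat through a core of size \<open>k\<close> would have to come from the
    edge \<open>S\<close> itself, which has no vertex outside \<open>M\<close>.\<close>
  have "False" if "y \<in> threats V E M S" for y
  proof -
    obtain e where e: "e \<in> E" "S \<subseteq> e" "y \<in> e" "y \<notin> M" using \<open>y \<in> _\<close> by (auto simp: threats_def)
    have "finite e" "card S = card e" using E[OF e(1)] 0 V finite_subset by auto
    then have "S = e" using card_subset_eq e(2) by blast
    then show False using e "0.prems" by auto
  qed
  then have "threats V E M S = {}" by blast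
  then show ?case using n[of "card S"] 0 by simp
next
  case (Suc d)
  have V: "finite V" and E: "\<And>e. e \<in> E \<Longrightarrow> e \<subseteq> V \<and> card e = k"
    using H by (auto simp: uniform_hypergraph_def)
  have fS: "finite S" using Suc.prems M V by (meson finite_subset)
  define l where "l = card S"
  have l: "1 \<le> l" "l < k" using Suc by (auto simp: l_def)
  define T where "T = threats V E M S"
  have finT: "finite (threats V E M S')" for S' using V by (simp add: threats_def)
  have "\<forall>y\<in>T. \<exists>e\<in>E. S \<subseteq> e \<and> y \<in> e \<and> e \<subseteq> insert y M" by (auto simp: T_def threats_def)
  \<comment> \<open>One edge is fixed for each threat, so that \<open>W\<close> has exactly as many
    entries as there are threats.\<close>
  then obtain f where f: "\<And>y. y \<in> T \<Longrightarrow> f y \<in> E \<and> S \<subseteq> f y \<and> y \<in> f y \<and> f y \<subseteq> insert y M"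
    by metis
  have TM: "y \<notin> M" "y \<in> V" if "y \<in> T" for y using that by (auto simp: T_def threats_def)
  define W where "W = (\<lambda>y. (f y, y)) ` T"
  have cW: "card W = card T" unfolding W_def by (rule card_image) (auto simp: inj_on_def)
  have finW: "finite W" using finT by (simp add: W_def T_def)
  \<comment> \<open>A petal has at most \<open>k\<close> vertices, and by induction at most
    \<open>n (Suc l)\<close> threats pass through \<open>S\<close> and any one of them.\<close>
  define c where "c = real k * n (Suc l)"
  have c0: "0 \<le> c" using n[of "Suc l"] l by (simp add: c_def)
  let ?R = "\<lambda>a b. petal S a \<inter> petal S b = {}"
  have conflict: "real (card {a \<in> W. \<not> ?R a b}) \<le> c" if b: "b \<in> W" for b
  proof -
    obtain y where y: "y \<in> T" "b = (f y, y)" using b by (auto simp: W_def)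
    have yS: "y \<in> f y - S" using f[OF y(1)] TM[OF y(1)] Suc.prems by auto
    have pb: "finite (petal S b)" "card (petal S b) \<le> k"
      using card_petal[OF H, of "f y" S y] f[OF y(1)] yS by (auto simp: y)
    have pM: "petal S b \<subseteq> M - S" using f[OF y(1)] by (auto simp: y petal_def)
    have one: "real (card {a \<in> W. z \<in> petal S a}) \<le> n (Suc l)" if z: "z \<in> petal S b" for z
    proof -
      have zM: "z \<in> M" "z \<notin> S" using z pM by auto
      have "card {a \<in> W. z \<in> petal S a} = card (snd ` {a \<in> W. z \<in> petal S a})"
        by (rule card_image[symmetric]) (auto simp: inj_on_def W_def)
      also have "\<dots> \<le> card (threats V E M (insert z S))"
      proof (intro card_mono finT subsetI)
        fix y' assume "y' \<in> snd ` {a \<in> W. z \<in> petal S a}"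
        then have y': "y' \<in> T" "z \<in> f y'" by (auto simp: W_def petal_def)
        then show "y' \<in> threats V E M (insert z S)"
          using f[OF y'(1)] TM[OF y'(1)] unfolding threats_def by blast
      qed
      finally have "real (card {a \<in> W. z \<in> petal S a}) \<le> real (card (threats V E M (insert z S)))"
        by simp
      also have "\<dots> \<le> n (card (insert z S))"
        by (rule Suc.hyps(1)) (use Suc zM fS l in \<open>auto simp: l_def\<close>)
      finally show ?thesis using zM fS by (simp add: l_def)
    qed
    have "{a \<in> W. \<not> ?R a b} \<subseteq> (\<Union>z\<in>petal S b. {a \<in> W. z \<in> petal S a})" by auto
    then have "card {a \<in> W. \<not> ?R a b} \<le> card (\<Union>z\<in>petal S b. {a \<in> W. z \<in> petal S a})"
      using finW pb(1) by (intro card_mono) auto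
    also have "\<dots> \<le> (\<Sum>z\<in>petal S b. card {a \<in> W. z \<in> petal S a})"
      using pb(1) by (rule card_UN_le)
    finally have "real (card {a \<in> W. \<not> ?R a b}) \<le> (\<Sum>z\<in>petal S b. real (card {a \<in> W. z \<in> petal S a}))"
      by (simp only: of_nat_sum[symmetric] of_nat_le_iff)
    also have "\<dots> \<le> (\<Sum>z\<in>petal S b. n (Suc l))" by (rule sum_mono) (rule one)
    also have "\<dots> = real (card (petal S b)) * n (Suc l)" by simp
    also have "\<dots> \<le> c"
      unfolding c_def by (rule mult_right_mono) (use pb(2) n[of "Suc l"] l in auto)
    finally show ?thesis .
  qed
  have "real (card T) \<le> real (p l) * c + g l"
  \<comment> \<open>With fewer than \<open>p l * c\<close> threats the bound is immediate. Otherwise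
    the lower bound on compatible lists meets the upper bound on occupied flowers, and
    \<open>p l\<close>-th roots are taken.\<close>
  proof (cases "real (p l) * c \<le> real (card W)")
    case True
    have "(real (card W) - real (p l) * c) ^ p l \<le>
        real (card {L. set L \<subseteq> W \<and> length L = p l \<and> sorted_wrt ?R L})"
      by (rule card_compatible_lists_ge[OF finW conflict c0 True]) auto
    also have "\<dots> \<le> real (card {L \<in> flowers E S (p l). flower_set S L \<subseteq> M})"
    proof (intro of_nat_mono card_mono)
      show "finite {L \<in> flowers E S (p l). flower_set S L \<subseteq> M}"
        using card_flowers_le(1)[OF H, of S "p l"] Suc.prems M by auto
      have W: "a \<in> {(e, y). e \<in> E \<and> S \<subseteq> e \<and> y \<in> e - S} \<and> petal S a \<subseteq> M" if a: "a \<in> W" for a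
      proof -
        obtain y where y: "y \<in> T" "a = (f y, y)" using a by (auto simp: W_def)
        show ?thesis using f[OF y(1)] TM[OF y(1)] Suc.prems(1) by (auto simp: y(2) petal_def)
      qed
      show "{L. set L \<subseteq> W \<and> length L = p l \<and> sorted_wrt ?R L} \<subseteq>
          {L \<in> flowers E S (p l). flower_set S L \<subseteq> M}"
      proof
        fix L assume L: "L \<in> {L. set L \<subseteq> W \<and> length L = p l \<and> sorted_wrt ?R L}"
        then have "flower_set S L \<subseteq> M"
          using W Suc.prems(1) unfolding flower_set_def by blast
        then show "L \<in> {L \<in> flowers E S (p l). flower_set S L \<subseteq> M}"
          using L W unfolding flowers_def by blast
      qed
    qed
    also have "\<dots> \<le> g l ^ p l" using few[of S] Suc.prems l by (simp add: l_def)
    finally have "real (card W) - real (p l) * c \<le> g l"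
      using p[OF l] g[OF l] True by (simp add: power_mono_iff)
    then show ?thesis using cW by simp
  next
    case False
    then show ?thesis using cW g[OF l] by simp
  qed
  also have "\<dots> \<le> n l" using rec[OF l] by (simp add: c_def)
  finally show ?case by (simp add: T_def l_def)
qed

section \<open>Weighting the flowers\<close>

text \<open>With the empty set included the sum is a product over \<open>V\<close>, at most the
  square root of e and so at most 2. This allows each core \<open>S\<close> the share
  \<open>?c ^ card S\<close> of the initial potential, where \<open>?c\<close> is the base of the
  powers.\<close>

lemma sum_nonempty_subsets_le_1:
  fixes V :: "'a set"
  assumes "finite V" "V \<noteq> {}"
  shows "(\<Sum>S\<in>Pow V - {{}}. (1 / (2 * real (card V))) ^ card S) \<le> 1"
proof -
  let ?v = "real (card V)"
  let ?c = "1 / (2 * ?v)"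
  have v: "?v > 0" using assms by (simp add: card_gt_0_iff)
  have "(\<Sum>S\<in>Pow V. ?c ^ card S) = (\<Prod>x\<in>V. ?c + 1)"
    using assms(1) by (subst prod_add) simp_all
  also have "\<dots> = (1 + ?c) ^ card V" by (simp add: add.commute)
  also have "\<dots> \<le> exp ?c ^ card V" using v by (intro power_mono exp_ge_add_one_self) auto
  also have "\<dots> = exp (1 / 2)" using v by (simp add: exp_of_nat_mult[symmetric])
  also have "\<dots> \<le> 2" by (rule exp_half_le2)
  finally have "(\<Sum>S\<in>Pow V. ?c ^ card S) \<le> 2" .
  then show ?thesis using assms(1) by (simp add: sum_diff1)
qed

text \<open>A flower with core size \<open>l\<close> weighs \<open>1 / g l ^ p l\<close>, so an
  occupied weight of at most 1 bounds the occupied flowers of every core at once.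
  \<open>small\<close> keeps the initial contribution of each core within its share, and
  \<open>rec\<close> turns bounds on flowers into bounds on threats.\<close>

lemma breaker_wins_by_flowers:
  fixes n g :: "nat \<Rightarrow> real" and p :: "nat \<Rightarrow> nat"
  assumes H: "uniform_hypergraph V E k" and k: "2 \<le> k" and ne: "V \<noteq> {}"
    and g: "\<And>l. 1 \<le> l \<Longrightarrow> l < k \<Longrightarrow> 0 < g l" and p: "\<And>l. 1 \<le> l \<Longrightarrow> l < k \<Longrightarrow> 0 < p l"
    and n: "\<And>l. 1 \<le> l \<Longrightarrow> l \<le> k \<Longrightarrow> 0 \<le> n l"
    and rec: "\<And>l. 1 \<le> l \<Longrightarrow> l < k \<Longrightarrow> real (p l) * (real k * n (Suc l)) + g l \<le> n l"
    and small: "\<And>l. 1 \<le> l \<Longrightarrow> l < k \<Longrightarrow> (2 * real (card V)) ^ l *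
      (real (max_hdeg V E l) * real k / ((1 + real b) ^ (k - 1 - l) * g l)) ^ p l \<le> 1"
    and q: "n 1 + real b \<le> real q"
  shows "breaker_wins V E q"
proof -
  have V: "finite V" and E: "\<And>e. e \<in> E \<Longrightarrow> e \<subseteq> V \<and> card e = k"
    using H by (auto simp: uniform_hypergraph_def)
  have v: "real (card V) > 0" using V ne by (simp add: card_gt_0_iff)
  let ?r = "1 / (1 + real b)" and ?c = "1 / (2 * real (card V))"
  define K where "K = {S. S \<subseteq> V \<and> 1 \<le> card S \<and> card S < k}"
  define fl where "fl = (\<lambda>S. flowers E S (p (card S)))"
  define I where "I = Sigma K fl"
  define A where "A = (\<lambda>(S, L). flower_set S L :: 'a set)"
  define w where "w = (\<lambda>(S :: 'a set, L :: ('a set \<times> 'a) list). 1 / g (card S) ^ p (card S))"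
  have finK: "finite K" using V by (auto simp: K_def)
  have finfl: "finite (fl S)" if "S \<in> K" for S
    using that card_flowers_le(1)[OF H] by (auto simp: K_def fl_def)
  have finI: "finite I" using finK finfl by (auto simp: I_def)
  have w0: "0 \<le> w i" if "i \<in> I" for i
    using that g by (auto simp: I_def w_def K_def less_imp_le)
  have AV: "A i \<subseteq> V" if "i \<in> I" for i
    using that E by (fastforce simp: I_def A_def K_def fl_def flower_set_def flowers_def petal_def)
  have perS: "(\<Sum>L\<in>fl S. w (S, L) * ?r ^ card (A (S, L))) \<le> ?r * ?c ^ card S" if S: "S \<in> K" for S
  proof -
    define l where "l = card S"
    have l: "1 \<le> l" "l < k" and SV: "S \<subseteq> V" using S by (auto simp: l_def K_def)
    have fS: "finite S" using SV V finite_subset by blast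
    let ?D = "real (max_hdeg V E l) * real k"
    have gp: "0 < g l ^ p l" using g[OF l] by simp
    have "(\<Sum>L\<in>fl S. w (S, L) * ?r ^ card (A (S, L))) =
        (\<Sum>L\<in>fl S. 1 / g l ^ p l * ?r ^ (l + p l * (k - 1 - l)))"
      by (rule sum.cong) (auto simp: w_def A_def l_def fl_def card_flower_set[OF H fS])
    also have "\<dots> = real (card (fl S)) * (1 / g l ^ p l * ?r ^ (l + p l * (k - 1 - l)))" by simp
    also have "\<dots> \<le> ?D ^ p l * (1 / g l ^ p l * (?r * ?r ^ (p l * (k - 1 - l))))"
    proof (intro mult_mono)
      have "real (card (fl S)) \<le> real ((max_hdeg V E l * k) ^ p l)"
        unfolding fl_def l_def by (intro of_nat_mono card_flowers_le(2)[OF H SV])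
      then show "real (card (fl S)) \<le> ?D ^ p l" by simp
      \<comment> \<open>One factor from the core is kept: it is the \<open>1 / (1 + b)\<close>
        required of the initial potential.\<close>
      have "?r ^ l \<le> ?r ^ 1" by (rule power_decreasing) (use l in auto)
      then show "?r ^ (l + p l * (k - 1 - l)) \<le> ?r * ?r ^ (p l * (k - 1 - l))"
        unfolding power_add power_one_right by (rule mult_right_mono) simp
    qed (use gp in auto)
    also have "\<dots> = ?r * (?D / ((1 + real b) ^ (k - 1 - l) * g l)) ^ p l"
      by (simp add: power_divide power_mult_distrib power_mult[symmetric] mult.commute)
    also have "\<dots> \<le> ?r * ?c ^ l"
    proof (rule mult_left_mono)
      have "0 < (2 * real (card V)) ^ l" using v by simp
      then show "(?D / ((1 + real b) ^ (k - 1 - l) * g l)) ^ p l \<le> ?c ^ l"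
        using small[OF l] unfolding power_one_over by (simp add: pos_le_divide_eq mult.commute)
    qed simp
    finally show ?thesis by (simp add: l_def)
  qed
  show ?thesis
  proof (rule breaker_wins_by_potential[where I=I and w=w and A=A and b=b])
    show "finite V" by fact
    show "e \<subseteq> V \<and> 2 \<le> card e" if "e \<in> E" for e using E[OF that] k by simp
    show "finite I" by fact
    show "0 \<le> w i" "A i \<subseteq> V" if "i \<in> I" for i using that w0 AV by auto
    have "(\<Sum>i\<in>I. w i * ?r ^ card (A i)) = (\<Sum>S\<in>K. \<Sum>L\<in>fl S. w (S, L) * ?r ^ card (A (S, L)))"
      unfolding I_def using finK finfl by (subst sum.Sigma) (auto intro!: sum.cong)
    also have "\<dots> \<le> (\<Sum>S\<in>K. ?r * ?c ^ card S)" by (rule sum_mono) (rule perS)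
    also have "\<dots> = ?r * (\<Sum>S\<in>K. ?c ^ card S)" by (simp only: sum_distrib_left)
    also have "\<dots> \<le> ?r * (\<Sum>S\<in>Pow V - {{}}. ?c ^ card S)"
      by (intro mult_left_mono sum_mono2) (use V in \<open>auto simp: K_def\<close>)
    also have "\<dots> \<le> ?r * 1"
      by (intro mult_left_mono sum_nonempty_subsets_le_1) (use V ne in auto)
    finally show "(\<Sum>i\<in>I. w i * ?r ^ card (A i)) \<le> ?r" by simp
  next
    fix M x assume M: "M \<subseteq> V" and x: "x \<in> M" and le1: "(\<Sum>i\<in>{i \<in> I. A i \<subseteq> M}. w i) \<le> 1"
    have few: "real (card {L \<in> flowers E S (p (card S)). flower_set S L \<subseteq> M}) \<le> g (card S) ^ p (card S)"
      if S: "S \<subseteq> M" "1 \<le> card S" "card S < k" for S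
    proof -
      let ?L = "{L \<in> flowers E S (p (card S)). flower_set S L \<subseteq> M}"
      have gp: "0 < g (card S) ^ p (card S)" using g[OF S(2,3)] by simp
      have "real (card ?L) / g (card S) ^ p (card S) = (\<Sum>i\<in>Pair S ` ?L. w i)"
        by (subst sum.reindex) (auto simp: inj_on_def w_def)
      also have "\<dots> \<le> (\<Sum>i\<in>{i \<in> I. A i \<subseteq> M}. w i)"
        by (rule sum_mono2) (use finI w0 S M in \<open>auto simp: I_def K_def fl_def A_def\<close>)
      finally have "real (card ?L) / g (card S) ^ p (card S) \<le> 1" using le1 by linarith
      then show ?thesis using gp by (simp add: pos_divide_le_eq)
    qed
    have "real (card (threats V E M {x})) \<le> n (card {x})"
      by (rule card_threats_le[OF H M g p n rec few]) (use x k in auto)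
    then show "card (threats V E M {x}) + b \<le> q" using q by simp
  qed
qed

section \<open>Choice of the parameters\<close>

text \<open>Taking \<open>p\<close>-th roots turns the cost \<open>X ^ l\<close> of choosing the
  core into \<open>X powr (l / p)\<close>, which is why many petals are wanted.\<close>

lemma power_ratio_le_1:
  fixes X R g :: real
  assumes "0 < X" "0 \<le> R" "0 < g" "0 < p" "X powr (real l / real p) * R \<le> g"
  shows "X ^ l * (R / g) ^ p \<le> 1"
proof -
  have "X ^ l = (X powr (real l / real p)) ^ p"
    using assms(1,4) by (simp add: powr_realpow[symmetric] powr_powr)
  then have "X ^ l * (R / g) ^ p = (X powr (real l / real p) * R / g) ^ p"
    by (simp add: power_mult_distrib power_divide)
  also have "\<dots> \<le> 1" by (rule power_le_one) (use assms in \<open>auto simp: field_simps\<close>)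
  finally show ?thesis .
qed

lemma powr_inverse_power:
  fixes x :: real
  assumes "0 \<le> x" "0 < m"
  shows "(x powr (1 / real m)) ^ m = x"
  using assms by (cases "x = 0") (simp_all add: powr_realpow[symmetric] powr_powr)

theorem theorem3p1:
  fixes V :: "'a set" and E :: "'a set set" and k q :: nat and t :: real
  assumes "k \<ge> 2"
    and "t > (2 * real k) ^ k"
    and "uniform_hypergraph V E k"
    and "real q > 4 * max
      (((2 * real (card V)) powr (1 / t) * real (max_hdeg V E 1) * real k * exp 1)
          powr (1 / (real k - 1)))
      (2 * (real k)\<^sup>2 * t ^ 3 *
        (Max (insert 0 ((\<lambda>l. (real (max_hdeg V E l) *
              ((t * real k) powr (t * real k) * real k powr t * (real (card V))\<^sup>2)
                powr (real k / t powr (1 / real k)))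
            powr (1 / (real k - real l))) ` {2..k - 1})) + 2))"
  shows "breaker_wins V E q"
proof (cases "V = {}")
  case True
  then have "E = {}" using assms(1,3) by (fastforce simp: uniform_hypergraph_def)
  then show ?thesis
    unfolding breaker_wins_def legal_breaker_strategy_def by (intro exI[of _ "\<lambda>_ _. {}"]) auto
next
  case False
  have V: "finite V" using assms(3) by (simp add: uniform_hypergraph_def)
  define v where "v = real (card V)"
  have v: "1 \<le> v" using V False by (simp add: v_def Suc_le_eq card_gt_0_iff)
  define \<Delta> where "\<Delta> = (\<lambda>l. real (max_hdeg V E l))"
  define \<tau> where "\<tau> = t powr (1 / real k)"
  define F where "F = ((t * real k) powr (t * real k) * real k powr t * v\<^sup>2) powr (real k / \<tau>)"
  \<comment> \<open>Normalised so that the second term of the maximum yields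
    \<open>mx + 2 < Q\<close>.\<close>
  define Q where "Q = real q / (8 * (real k)\<^sup>2 * t ^ 3)"
  have k: "2 \<le> real k" using assms(1) by simp
  have "(2 * real k) ^ 1 \<le> (2 * real k) ^ k" by (rule power_increasing) (use assms(1) k in auto)
  then have t4: "4 < t" using assms(2) k by simp
  have tk: "real k ^ k \<le> t"
    using assms(2) power_mono[of "real k" "2 * real k" k] by simp
  have \<tau>k: "\<tau> ^ k = t"
    using t4 assms(1) by (simp add: \<tau>_def powr_realpow[symmetric] powr_powr)
  have \<tau>0: "0 < \<tau>" using t4 by (simp add: \<tau>_def)
  have \<tau>: "2 * real k < \<tau>"
    by (rule power_less_imp_less_base[of _ k]) (use \<tau>k assms(2) \<tau>0 in auto)
  have den: "0 < 8 * (real k)\<^sup>2 * t ^ 3" using k t4 by simp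
  define mx where "mx = Max (insert 0 ((\<lambda>l. (\<Delta> l * F) powr (1 / (real k - real l))) ` {2..k - 1}))"
  have q: "4 * max (((2 * v) powr (1 / t) * \<Delta> 1 * real k * exp 1) powr (1 / (real k - 1)))
      (2 * (real k)\<^sup>2 * t ^ 3 * (mx + 2)) < real q"
    using assms(4) by (simp only: v_def \<Delta>_def F_def \<tau>_def mx_def)
  have max0: "0 \<le> mx" unfolding mx_def by (rule Max_ge) auto
  have "8 * (real k)\<^sup>2 * t ^ 3 * (mx + 2) < real q" using q by simp
  then have "mx + 2 < Q" unfolding Q_def using den by (simp add: pos_less_divide_eq mult.commute)
  then have Q: "mx \<le> Q" "0 < Q" using max0 by linarith+
  have q0: "0 < real q" using Q(2) den by (simp add: Q_def zero_less_divide_iff)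
  have "1 \<le> 2 * (real k)\<^sup>2 * t ^ 3"
  proof -
    have "1 \<le> (real k)\<^sup>2" "1 \<le> t ^ 3" using k t4 by auto
    then have "1 * 1 \<le> (real k)\<^sup>2 * t ^ 3" by (intro mult_mono) auto
    then show ?thesis by simp
  qed
  then have Qq: "Q \<le> real q / 4"
    unfolding Q_def using q0 by (intro divide_left_mono) (auto simp: mult.commute mult.left_commute)
  define b where "b = q div 2"
  have b: "real b \<le> real q / 2" "real q / 4 \<le> 1 + real b" by (auto simp: b_def)
  \<comment> \<open>At least \<open>\<tau> / 2\<close>, to keep the exponent \<open>l / p2\<close>
    below \<open>2 * k / \<tau>\<close>; at most \<open>\<tau>\<close>, so that \<open>a ^ k\<close>
    stays below \<open>\<tau> ^ k * k ^ k = t * k ^ k\<close>.\<close>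
  define p2 where "p2 = nat \<lceil>\<tau> / 2\<rceil>"
  have p2: "\<tau> / 2 \<le> real p2" "real p2 \<le> \<tau>" "0 < p2"
    using \<tau> k by (auto simp: p2_def) linarith+
  define a where "a = real p2 * real k"
  have a2: "2 \<le> a"
  proof -
    have "1 * 2 \<le> a" unfolding a_def by (intro mult_mono) (use p2 k in auto)
    then show ?thesis by simp
  qed
  have ak: "a ^ (k - 2) \<le> t\<^sup>2"
  proof -
    have "a ^ (k - 2) \<le> a ^ k" by (rule power_increasing) (use a2 in auto)
    also have "\<dots> \<le> (\<tau> * real k) ^ k"
      unfolding a_def by (intro power_mono mult_right_mono) (use p2 in auto)
    also have "\<dots> = t * real k ^ k" by (simp add: power_mult_distrib \<tau>k)
    also have "\<dots> \<le> t * t" using tk t4 by (intro mult_left_mono) auto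
    finally show ?thesis by (simp add: power2_eq_square)
  qed
  define p1 where "p1 = nat \<lceil>t\<rceil>"
  have p1: "t \<le> real p1" "real p1 \<le> 2 * t" "0 < p1" using t4 by (auto simp: p1_def) linarith+
  \<comment> \<open>\<open>n\<close> solves the recursion \<open>n l = a * n (l + 1) + k * Q\<close> from \<open>n k = 0\<close> up to a surplus that is
    harmless because \<open>a \<ge> 2\<close>.\<close>
  define p where "p = (\<lambda>l :: nat. if l = 1 then p1 else p2)"
  define g where "g = (\<lambda>l :: nat. if l = 1 then real q / 4 else real k * Q)"
  define n where "n = (\<lambda>l :: nat. if l = 1 then real q / 2 else real k * Q * (a ^ (k - l) - 1))"
  have a1: "1 \<le> a ^ m" for m using a2 by simp
  have kQ: "0 < real k * Q" using k Q by simp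
  \<comment> \<open>The value \<open>n 1 = q / 2\<close> splits evenly into this product and
    \<open>g 1\<close>. The product is at most \<open>2 * k^2 * t^3 * Q\<close>, which the
    denominator of \<open>Q\<close> makes equal to \<open>q / 4\<close>.\<close>
  have n2: "real p1 * (real k * n 2) \<le> real q / 4"
  proof -
    have "n 2 \<le> real k * Q * t\<^sup>2"
      unfolding n_def using ak kQ by (auto intro!: mult_left_mono)
    then have "real p1 * (real k * n 2) \<le> (2 * t) * (real k * (real k * Q * t\<^sup>2))"
      using p1 t4 kQ a1[of "k - 2"] by (intro mult_mono) (auto simp: n_def)
    also have "\<dots> = real q / 4"
      unfolding Q_def using k t4 by (simp add: field_simps power2_eq_square power3_eq_cube)
    finally show ?thesis .
  qed
  show ?thesis
  proof (rule breaker_wins_by_flowers[OF assms(3,1) False, where g=g and p=p and n=n and b=b])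
    show "0 < g l" for l using q0 kQ by (simp add: g_def)
    show "0 < p l" for l using p1 p2 by (simp add: p_def)
    show "0 \<le> n l" for l using kQ a1 q0 by (simp add: n_def)
    show "n 1 + real b \<le> real q" using b by (simp add: n_def)
  next
    fix l assume l: "1 \<le> l" "l < k"
    show "real (p l) * (real k * n (Suc l)) + g l \<le> n l"
    proof (cases "l = 1")
      case True
      then show ?thesis using n2 by (simp add: p_def g_def n_def numeral_2_eq_2)
    next
      case False
      have "a ^ (k - l) = a * a ^ (k - Suc l)" using l by (metis Suc_diff_Suc power_Suc)
      then have "n l - (real (p l) * (real k * n (Suc l)) + g l) = real k * Q * (a - 2)"
        using False l by (simp add: p_def g_def n_def a_def algebra_simps)
      moreover have "0 \<le> real k * Q * (a - 2)" using kQ a2 by simp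
      ultimately show ?thesis by linarith
    qed
  next
    fix l assume l: "1 \<le> l" "l < k"
    have bpos: "0 < 1 + real b" by simp
    have "(2 * v) powr (real l / real (p l)) * (\<Delta> l * real k / (1 + real b) ^ (k - 1 - l)) \<le> g l"
    proof (cases "l = 1")
      case True
      let ?Y = "(2 * v) powr (1 / t) * \<Delta> 1 * real k"
      have Y0: "0 \<le> ?Y" using v by (simp add: \<Delta>_def)
      have "?Y * 1 \<le> ?Y * exp 1" by (rule mult_left_mono) (use Y0 in auto)
      \<comment> \<open>The first term of the maximum is raised to the power \<open>k - 1\<close>:
        one factor \<open>q / 4\<close> becomes \<open>g 1\<close>, the other \<open>k - 2\<close>
        are absorbed by powers of \<open>1 + b\<close>.\<close>
      also have "?Y * exp 1 = ((?Y * exp 1) powr (1 / (real k - 1))) ^ (k - 1)"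
        using powr_inverse_power[of "?Y * exp 1" "k - 1"] Y0 assms(1) by (simp add: of_nat_diff)
      also have "\<dots> \<le> (real q / 4) ^ (k - 1)" by (rule power_mono) (use q in auto)
      also have "\<dots> = real q / 4 * (real q / 4) ^ (k - 2)"
      proof -
        have "k - 1 = Suc (k - 2)" using assms(1) by simp
        then show ?thesis by (simp only: power_Suc)
      qed
      also have "\<dots> \<le> real q / 4 * (1 + real b) ^ (k - 2)"
        by (intro mult_left_mono power_mono b) auto
      finally have Y: "?Y \<le> real q / 4 * (1 + real b) ^ (k - 2)" by simp
      have "(2 * v) powr (1 / real p1) \<le> (2 * v) powr (1 / t)"
        by (rule powr_mono) (use v p1 t4 in \<open>auto intro!: divide_left_mono\<close>)
      then have "(2 * v) powr (1 / real p1) * \<Delta> 1 * real k \<le> ?Y"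
        by (intro mult_right_mono) (auto simp: \<Delta>_def)
      then have "(2 * v) powr (1 / real p1) * \<Delta> 1 * real k \<le> real q / 4 * (1 + real b) ^ (k - 2)"
        using Y by linarith
      then show ?thesis
        using True bpos by (simp add: p_def g_def pos_divide_le_eq mult.assoc numeral_2_eq_2)
    next
      case False
      then have l2: "2 \<le> l" using l by simp
      have exponent: "real l / real p2 \<le> 2 * (real k / \<tau>)"
      proof -
        have "real l / real p2 \<le> real k / (\<tau> / 2)"
          by (rule frac_le) (use l p2 \<tau>0 in auto)
        then show ?thesis by (simp add: mult.commute)
      qed
      have "(2 * v) powr (real l / real p2) \<le> (2 * v) powr (2 * (real k / \<tau>))"
        by (rule powr_mono[OF exponent]) (use v in auto)
      also have "\<dots> = ((2 * v)\<^sup>2) powr (real k / \<tau>)"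
      proof -
        have "(2 * v)\<^sup>2 = (2 * v) powr 2" using v by simp
        then show ?thesis by (simp only: powr_powr)
      qed
      also have "\<dots> \<le> F"
        unfolding F_def
      proof (rule powr_mono2)
        \<comment> \<open>The factor 4 of \<open>(2 * v)\<^sup>2\<close> is covered by
          \<open>(t * k) powr (t * k)\<close>.\<close>
        have "4 * 1 \<le> t * real k" by (intro mult_mono) (use t4 k in auto)
        then have "4 powr 1 \<le> (t * real k) powr (t * real k)"
          by (intro powr_mono_both) auto
        moreover have "1 \<le> real k powr t" using k t4 by (intro ge_one_powr_ge_zero) auto
        ultimately have "4 * 1 \<le> (t * real k) powr (t * real k) * real k powr t"
          by (intro mult_mono) auto
        then show "(2 * v)\<^sup>2 \<le> (t * real k) powr (t * real k) * real k powr t * v\<^sup>2"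
          unfolding power_mult_distrib by (intro mult_right_mono) auto
      qed (use \<tau>0 in auto)
      finally have XF: "(2 * v) powr (real l / real p2) \<le> F" .
      have F0: "0 \<le> F" by (simp add: F_def)
      have "(\<Delta> l * F) powr (1 / (real k - real l)) \<le> mx"
        unfolding mx_def by (rule Max_ge) (use l l2 in auto)
      then have DQ: "(\<Delta> l * F) powr (1 / (real k - real l)) \<le> Q" using Q by linarith
      have D0: "0 \<le> \<Delta> l * F" using F0 by (simp add: \<Delta>_def)
      \<comment> \<open>Of the \<open>k - l\<close> factors \<open>Q\<close>, one goes into
        \<open>g l = k * Q\<close> and the others are absorbed by powers of
        \<open>1 + b\<close>.\<close>
      have "\<Delta> l * F = ((\<Delta> l * F) powr (1 / (real k - real l))) ^ (k - l)"
        using powr_inverse_power[of "\<Delta> l * F" "k - l"] D0 l by (simp add: of_nat_diff)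
      also have "\<dots> \<le> Q ^ (k - l)" by (rule power_mono[OF DQ]) simp
      also have "\<dots> = Q * Q ^ (k - 1 - l)"
      proof -
        have "k - l = Suc (k - 1 - l)" using l by simp
        then show ?thesis by (simp only: power_Suc)
      qed
      also have "\<dots> \<le> Q * (1 + real b) ^ (k - 1 - l)"
        by (intro mult_left_mono power_mono) (use Q Qq b in auto)
      finally have DF: "\<Delta> l * F \<le> Q * (1 + real b) ^ (k - 1 - l)" .
      have "(2 * v) powr (real l / real p2) * (\<Delta> l * real k) \<le> F * (\<Delta> l * real k)"
        by (intro mult_right_mono XF) (simp add: \<Delta>_def)
      also have "\<dots> = real k * (\<Delta> l * F)" by simp
      also have "\<dots> \<le> real k * (Q * (1 + real b) ^ (k - 1 - l))"
        by (intro mult_left_mono DF) auto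
      finally show ?thesis
        using False bpos by (simp add: p_def g_def pos_divide_le_eq mult.assoc)
    qed
    then have "(2 * v) ^ l * (\<Delta> l * real k / (1 + real b) ^ (k - 1 - l) / g l) ^ p l \<le> 1"
      by (intro power_ratio_le_1) (use v q0 kQ p1 p2 in \<open>auto simp: \<Delta>_def g_def p_def\<close>)
    then show "(2 * real (card V)) ^ l *
        (real (max_hdeg V E l) * real k / ((1 + real b) ^ (k - 1 - l) * g l)) ^ p l \<le> 1"
      by (simp add: v_def \<Delta>_def)
  qed
qed

end
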